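(* Let $\Omega$ be a $\sigma$-algebra of subsets of a set $X$, $E$ a Banach lattice, and $\pi\colon\mathcal B(X)\to\mathcal L_{\mathrm r}(E)$ a positive representation. Then: (1) $\pi\colon\mathcal B(X)\to(\mathcal L_{\mathrm r}(E),\|\cdot\|)$ is bounded, and $\|\pi\|=\|\pi(\mathbf 1_X)\|$. (2) If $E$ is Dedekind complete, then $\pi\colon\mathcal B(X)\to(\mathcal L_{\mathrm r}(E),\|\cdot\|_{\mathrm r})$ is bounded, and $\|\pi\|=\|\pi\|_{\mathrm r}=\|\pi(\mathbf 1_X)\|$.
   Context: All vector spaces are real. $\mathcal B(X)$ is the Banach lattice algebra of bounded $\Omega$-measurable real-valued functions on $X$ (supremum norm, pointwise operations), and $\mathbf 1_X$ is the constant function $1$. $\mathcal L(E)$ denotes the bounded linear operators on $E$ with operator norm $\|\cdot\|$, and $\mathcal L_{\mathrm r}(E)\subset\mathcal L(E)$ the regular operators (differences of two positive linear operators). If $E$ is Dedekind complete, $\|T\|_{\mathrm r}=\||T|\|$ is the regular norm on $\mathcal L_{\mathrm r}(E)$. For a linear map $\pi$ into $\mathcal L_{\mathrm r}(E)$, $\|\pi\|$ and $\|\pi\|_{\mathrm r}$ denote its norm when the codomain carries $\|\cdot\|$, resp. $\|\cdot\|_{\mathrm r}$. A positive representation of $\mathcal B(X)$ on $E$ is an algebra homomorphism $\pi\colon\mathcal B(X)\to\mathcal L(E)$ with $\pi(\phi)$ a positive operator for every $\phi\geq0$; it is not assumed bounded or unital. *)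

theory Defs
  imports "HOL-Analysis.Analysis" "HOL-Library.Lattice_Algebras"
begin

class banach_lattice = banach + ordered_real_vector + lattice_ab_group_add_abs +
  assumes norm_mono_abs: "\<bar>x\<bar> \<le> \<bar>y\<bar> \<Longrightarrow> norm x \<le> norm y"

definition dedekind_complete :: "'e::order itself \<Rightarrow> bool" where
  "dedekind_complete _ \<longleftrightarrow>
    (\<forall>A::'e set. A \<noteq> {} \<and> bdd_above A \<longrightarrow>
      (\<exists>s. (\<forall>a\<in>A. a \<le> s) \<and> (\<forall>u. (\<forall>a\<in>A. a \<le> u) \<longrightarrow> s \<le> u)))"

text \<open>A function on \<open>X\<close> is represented by its extension by zero to the whole type, so that
  equality of representatives is equality on \<open>X\<close>, pointwise operations stay inside the set,
  and \<open>indicat_real X\<close> is the constant function one on \<open>X\<close>.\<close>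

definition bounded_measurable :: "'a set \<Rightarrow> 'a set set \<Rightarrow> ('a \<Rightarrow> real) set" where
  "bounded_measurable X \<Omega> =
    {f. f \<in> borel_measurable (sigma X \<Omega>) \<and> bounded (f ` X) \<and> (\<forall>x. x \<notin> X \<longrightarrow> f x = 0)}"

text \<open>The case distinction is needed because \<open>X\<close> may be empty and \<open>Sup {}\<close> is unspecified
  on the reals.\<close>

definition sup_norm :: "'a set \<Rightarrow> ('a \<Rightarrow> real) \<Rightarrow> real" where
  "sup_norm X f = (if X = {} then 0 else (SUP x\<in>X. \<bar>f x\<bar>))"

definition positive_operator :: "('e::banach_lattice \<Rightarrow> 'e) \<Rightarrow> bool" where
  "positive_operator S \<longleftrightarrow> linear S \<and> (\<forall>x\<ge>0. 0 \<le> S x)"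

text \<open>The two positive operators are only required to be linear; their boundedness is
  not part of the definition.\<close>

definition regular_operators :: "('e::banach_lattice \<Rightarrow>\<^sub>L 'e) set" where
  "regular_operators =
    {T. \<exists>S R. positive_operator S \<and> positive_operator R \<and>
          (\<forall>x. blinfun_apply T x = S x - R x)}"

definition operator_le :: "('e::banach_lattice \<Rightarrow>\<^sub>L 'e) \<Rightarrow> ('e \<Rightarrow>\<^sub>L 'e) \<Rightarrow> bool" where
  "operator_le S T \<longleftrightarrow> positive_operator (blinfun_apply (T - S))"

text \<open>The modulus is the supremum of \<open>T\<close> and \<open>- T\<close> in the ordered vector space of regular
  operators. It is meaningful for regular \<open>T\<close> when the underlying lattice is Dedekind complete;
  otherwise the supremum need not exist.\<close>

definition operator_modulus :: "('e::banach_lattice \<Rightarrow>\<^sub>L 'e) \<Rightarrow> ('e \<Rightarrow>\<^sub>L 'e)" where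
  "operator_modulus T =
    (THE S. S \<in> regular_operators \<and> operator_le T S \<and> operator_le (- T) S \<and>
      (\<forall>R\<in>regular_operators. operator_le T R \<and> operator_le (- T) R \<longrightarrow> operator_le S R))"

definition regular_norm :: "('e::banach_lattice \<Rightarrow>\<^sub>L 'e) \<Rightarrow> real" where
  "regular_norm T = norm (operator_modulus T)"

definition positive_representation ::
    "'a set \<Rightarrow> 'a set set \<Rightarrow> (('a \<Rightarrow> real) \<Rightarrow> ('e::banach_lattice \<Rightarrow>\<^sub>L 'e)) \<Rightarrow> bool" where
  "positive_representation X \<Omega> \<pi> \<longleftrightarrow>
    (\<forall>f\<in>bounded_measurable X \<Omega>. \<forall>g\<in>bounded_measurable X \<Omega>.
      \<pi> (\<lambda>x. f x + g x) = \<pi> f + \<pi> g) \<and>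
    (\<forall>c. \<forall>f\<in>bounded_measurable X \<Omega>. \<pi> (\<lambda>x. c * f x) = c *\<^sub>R \<pi> f) \<and>
    (\<forall>f\<in>bounded_measurable X \<Omega>. \<forall>g\<in>bounded_measurable X \<Omega>.
      \<pi> (\<lambda>x. f x * g x) = \<pi> f o\<^sub>L \<pi> g) \<and>
    (\<forall>f\<in>bounded_measurable X \<Omega>. (\<forall>x\<in>X. 0 \<le> f x) \<longrightarrow> positive_operator (blinfun_apply (\<pi> f)))"

text \<open>The parameter \<open>\<nu>\<close> is the norm carried by the codomain: \<open>norm\<close> or \<open>regular_norm\<close>.\<close>

definition bounded_representation ::
    "'a set \<Rightarrow> 'a set set \<Rightarrow> ('b \<Rightarrow> real) \<Rightarrow> (('a \<Rightarrow> real) \<Rightarrow> 'b) \<Rightarrow> bool" where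
  "bounded_representation X \<Omega> \<nu> \<pi> \<longleftrightarrow>
    (\<exists>C. \<forall>f\<in>bounded_measurable X \<Omega>. \<nu> (\<pi> f) \<le> C * sup_norm X f)"

definition representation_norm ::
    "'a set \<Rightarrow> 'a set set \<Rightarrow> ('b \<Rightarrow> real) \<Rightarrow> (('a \<Rightarrow> real) \<Rightarrow> 'b) \<Rightarrow> real" where
  "representation_norm X \<Omega> \<nu> \<pi> =
    (SUP f\<in>{f \<in> bounded_measurable X \<Omega>. sup_norm X f \<le> 1}. \<nu> (\<pi> f))"

end

theory Submission
  imports Defs
begin

text \<open>A function \<open>f\<close> with \<open>\<bar>f\<bar> \<le> c\<close> on \<open>X\<close> satisfies \<open>\<plusminus> \<pi> f \<le> c \<pi>(1)\<close>, which gives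
  \<open>\<bar>\<pi> f x\<bar> \<le> c \<pi>(1) \<bar>x\<bar>\<close> and hence the first part. Multiplicativity plays no role. For a
  non-unital \<open>\<pi>\<close> the modulus of \<open>\<pi> f\<close> can be strictly smaller than \<open>\<pi> \<bar>f\<bar>\<close>, so for the second
  part the modulus is built by the Riesz-Kantorovich formula
  \<open>\<bar>T\<bar> x = sup {T y | \<bar>y\<bar> \<le> x}\<close> for \<open>x \<ge> 0\<close>; being the least operator above \<open>\<plusminus> \<pi> f\<close>, it
  lies below \<open>c \<pi>(1)\<close>.\<close>

section \<open>Decomposition in a Banach lattice and extension from the positive cone\<close>

lemma norm_abs_banach_lattice: "norm \<bar>x\<bar> = norm (x::'e::banach_lattice)"
  by (rule antisym; rule norm_mono_abs) simp_all

text \<open>The library's \<open>nprt x\<close> is the nonpositive part, so \<open>- nprt x\<close>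
  is the usual negative part. In this form every element is a difference of two elements of the
  positive cone.\<close>

lemma pprt_diff: "pprt x - (- nprt x) = (x::'e::banach_lattice)"
  using prts[of x] by simp

text \<open>This is the Riesz decomposition property for order intervals symmetric about 0:
  \<open>u\<close> is \<open>y\<close> truncated to the interval from \<open>- a\<close> to
  \<open>a\<close>, and truncation moves \<open>y\<close> by at most \<open>b\<close>. It yields the
  subadditivity of the Riesz-Kantorovich supremum.\<close>

lemma abs_le_decompose:
  fixes y a b :: "'e::banach_lattice"
  assumes "\<bar>y\<bar> \<le> a + b" and "0 \<le> a" and "0 \<le> b"
  obtains u v where "y = u + v" and "\<bar>u\<bar> \<le> a" and "\<bar>v\<bar> \<le> b"
proof -
  define u where "u = sup (- a) (inf y a)"
  have y: "y \<le> a + b" "- y \<le> a + b"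
    using assms(1) abs_le_D1 abs_le_D2 by blast+
  have "u \<le> a"
    unfolding u_def using assms(2) by (simp add: order_trans[of "- a" 0 a])
  moreover have "- u \<le> a"
    unfolding u_def by (metis minus_le_iff sup_ge1)
  ultimately have u: "\<bar>u\<bar> \<le> a"
    by (rule abs_leI)
  have "y - b \<le> inf y a"
    using y(1) assms(3) by (simp add: diff_le_eq)
  then have "y - b \<le> u"
    unfolding u_def by (simp add: le_supI2)
  moreover have "u \<le> y + b"
  proof -
    have "- a \<le> y + b"
      using add_right_mono[OF y(2), of "y - a"] by (simp add: algebra_simps)
    moreover have "inf y a \<le> y + b"
      using assms(3) by (simp add: le_infI1)
    ultimately show ?thesis
      unfolding u_def by simp
  qed
  ultimately have "\<bar>y - u\<bar> \<le> b"
    by (intro abs_leI) (simp_all add: algebra_simps)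
  with u show thesis
    by (intro that[of u "y - u"]) simp_all
qed

text \<open>Kantorovich's extension argument: the cone generates the space, and additivity on the
  cone makes the value at a difference independent of how the difference is written.\<close>

lemma linear_extension_from_cone:
  fixes M :: "'e::banach_lattice \<Rightarrow> 'f::real_vector"
  assumes add: "\<And>a b. 0 \<le> a \<Longrightarrow> 0 \<le> b \<Longrightarrow> M (a + b) = M a + M b"
    and scale: "\<And>c a. 0 \<le> c \<Longrightarrow> 0 \<le> a \<Longrightarrow> M (c *\<^sub>R a) = c *\<^sub>R M a"
  obtains S where "linear S" and "\<And>x. 0 \<le> x \<Longrightarrow> S x = M x"
proof -
  define S where "S x = M (pprt x) - M (- nprt x)" for x
  \<comment> \<open>Independence of the decomposition: moving the subtracted terms across turns two
    representations of the same element into an equality of sums inside the cone, where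
    \<open>M\<close> is additive.\<close>
  have S_diff: "S (a - b) = M a - M b" if "0 \<le> a" "0 \<le> b" for a b
  proof -
    have "pprt (a - b) + b = a + (- nprt (a - b))"
      using pprt_diff[of "a - b"] by (simp add: algebra_simps)
    then have "M (pprt (a - b)) + M b = M a + M (- nprt (a - b))"
      using that by (metis add zero_le_pprt nprt_le_zero neg_0_le_iff_le)
    then show ?thesis
      by (simp add: S_def algebra_simps)
  qed
  have nonneg: "0 \<le> pprt x" "0 \<le> - nprt x" for x :: 'e
    by simp_all
  have "S (x + y) = S x + S y" for x y
  proof -
    have "x + y = (pprt x - (- nprt x)) + (pprt y - (- nprt y))"
      by (simp only: pprt_diff)
    also have "\<dots> = (pprt x + pprt y) - (- nprt x + - nprt y)"
      by (simp add: algebra_simps)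
    finally have "x + y = (pprt x + pprt y) - (- nprt x + - nprt y)" .
    then have "S (x + y) = M (pprt x + pprt y) - M (- nprt x + - nprt y)"
      using S_diff[of "pprt x + pprt y" "- nprt x + - nprt y"] nonneg
      by (metis add_nonneg_nonneg)
    then show ?thesis
      unfolding add[OF nonneg(1) nonneg(1)] add[OF nonneg(2) nonneg(2)] S_def by simp
  qed
  moreover have "S (c *\<^sub>R x) = c *\<^sub>R S x" for c x
  proof (cases "0 \<le> c")
    case True
    have "c *\<^sub>R x = c *\<^sub>R pprt x - c *\<^sub>R (- nprt x)"
      by (metis pprt_diff scaleR_diff_right)
    then have "S (c *\<^sub>R x) = M (c *\<^sub>R pprt x) - M (c *\<^sub>R (- nprt x))"
      using S_diff[of "c *\<^sub>R pprt x" "c *\<^sub>R (- nprt x)"] nonneg True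
      by (metis scaleR_nonneg_nonneg)
    then show ?thesis
      using scale[OF True nonneg(1)] scale[OF True nonneg(2)]
      by (simp only: S_def scaleR_diff_right)
  next
    case False
    then have c: "0 \<le> - c"
      by simp
    \<comment> \<open>A negative scalar exchanges the roles of the positive and negative parts, so
      only the nonnegative factor \<open>- c\<close> is pulled out of \<open>M\<close>.\<close>
    have "c *\<^sub>R x = (- c) *\<^sub>R (- nprt x) - (- c) *\<^sub>R pprt x"
      by (subst pprt_diff[of x, symmetric]) (simp add: scaleR_add_right)
    then have "S (c *\<^sub>R x) = M ((- c) *\<^sub>R (- nprt x)) - M ((- c) *\<^sub>R pprt x)"
      using S_diff[of "(- c) *\<^sub>R (- nprt x)" "(- c) *\<^sub>R pprt x"] nonneg c
      by (metis scaleR_nonneg_nonneg)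
    then show ?thesis
      unfolding scale[OF c nonneg(1)] scale[OF c nonneg(2)]
      by (simp add: S_def scaleR_diff_right)
  qed
  ultimately have "linear S"
    by (rule linearI)
  moreover have "S x = M x" if "0 \<le> x" for x
    using S_diff[of x 0] scale[of 0 0] that by simp
  ultimately show thesis
    by (rule that)
qed

section \<open>The operator order and norm estimates from domination\<close>

lemma linear_blinfun_apply: "linear (blinfun_apply T)"
  by (rule bounded_linear.linear[OF blinfun.bounded_linear_right])

lemma operator_le_iff: "operator_le S T \<longleftrightarrow> (\<forall>x\<ge>0. blinfun_apply S x \<le> blinfun_apply T x)"
  unfolding operator_le_def positive_operator_def
  by (simp add: linear_blinfun_apply blinfun.diff_left)

text \<open>The two operators agree on the positive cone, which generates the space. This gives the
  uniqueness behind the definite description in \<open>operator_modulus\<close>.\<close>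

lemma operator_le_antisym:
  assumes "operator_le S T" and "operator_le T S"
  shows "S = T"
proof (rule blinfun_eqI)
  fix x
  have eq: "blinfun_apply S y = blinfun_apply T y" if "0 \<le> y" for y
    using assms that by (simp add: operator_le_iff antisym)
  have "blinfun_apply S (pprt x - (- nprt x)) = blinfun_apply T (pprt x - (- nprt x))"
    unfolding blinfun.diff_right using eq[of "pprt x"] eq[of "- nprt x"] by simp
  then show "blinfun_apply S x = blinfun_apply T x"
    by (simp only: pprt_diff)
qed

text \<open>Split \<open>x\<close> into its positive and negative parts: \<open>T\<close> subtracts
  their images, \<open>U\<close> adds them, and the two hypotheses compare the summands one by
  one.\<close>

lemma linear_abs_le:
  fixes T U :: "'e::banach_lattice \<Rightarrow> 'e"
  assumes "linear T" and "linear U"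
    and "\<And>x. 0 \<le> x \<Longrightarrow> T x \<le> U x" and "\<And>x. 0 \<le> x \<Longrightarrow> - T x \<le> U x"
  shows "\<bar>T x\<bar> \<le> U \<bar>x\<bar>"
proof (rule abs_leI)
  have T: "T x = T (pprt x) - T (- nprt x)"
    using linear_diff[OF assms(1), of "pprt x" "- nprt x"] by (simp only: pprt_diff)
  have U: "U \<bar>x\<bar> = U (pprt x) + U (- nprt x)"
    using linear_add[OF assms(2), of "pprt x" "- nprt x"] by (simp add: abs_prts)
  have p: "0 \<le> pprt x" and n: "0 \<le> - nprt x"
    by simp_all
  show "T x \<le> U \<bar>x\<bar>"
    unfolding T U using add_mono[OF assms(3)[OF p] assms(4)[OF n]] by simp
  show "- T x \<le> U \<bar>x\<bar>"
    unfolding T U using add_mono[OF assms(4)[OF p] assms(3)[OF n]] by simp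
qed

text \<open>Here \<open>T\<close> is only linear, so that the estimate can also prove the
  boundedness of a newly constructed operator.\<close>

lemma dominated_linear_norm_le:
  fixes T :: "'e::banach_lattice \<Rightarrow> 'e" and U :: "'e \<Rightarrow>\<^sub>L 'e"
  assumes "linear T"
    and "\<And>x. 0 \<le> x \<Longrightarrow> T x \<le> blinfun_apply U x" and "\<And>x. 0 \<le> x \<Longrightarrow> - T x \<le> blinfun_apply U x"
  shows "norm (T x) \<le> norm U * norm x"
proof -
  have "\<bar>T x\<bar> \<le> blinfun_apply U \<bar>x\<bar>"
    using assms by (intro linear_abs_le) (simp_all add: linear_blinfun_apply)
  also have "\<dots> \<le> \<bar>blinfun_apply U \<bar>x\<bar>\<bar>"
    by (rule abs_ge_self)
  finally have "norm (T x) \<le> norm (blinfun_apply U \<bar>x\<bar>)"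
    by (rule norm_mono_abs)
  also have "\<dots> \<le> norm U * norm \<bar>x\<bar>"
    by (rule norm_blinfun)
  finally show ?thesis
    by (simp add: norm_abs_banach_lattice)
qed

lemma norm_le_of_operator_le:
  assumes "operator_le T U" and "operator_le (- T) U"
  shows "norm T \<le> norm U"
  using assms
  by (intro norm_blinfun_bound dominated_linear_norm_le)
    (simp_all add: operator_le_iff linear_blinfun_apply blinfun.minus_left)

lemma positive_blinfun_regular:
  "positive_operator (blinfun_apply S) \<Longrightarrow> S \<in> regular_operators"
  unfolding regular_operators_def
  by (intro CollectI exI[of _ "blinfun_apply S"] exI[of _ "\<lambda>_. 0"])
    (simp add: positive_operator_def linear_zero)

section \<open>The modulus and the regular norm\<close>

lemma operator_modulus_eqI:
  assumes "S \<in> regular_operators" and "operator_le T S" and "operator_le (- T) S"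
    and "\<And>R. R \<in> regular_operators \<Longrightarrow> operator_le T R \<Longrightarrow> operator_le (- T) R \<Longrightarrow> operator_le S R"
  shows "operator_modulus T = S"
  unfolding operator_modulus_def
  using assms by (intro the_equality) (auto intro: operator_le_antisym)

text \<open>Since \<open>- T\<close> lies below 0 and 0 below \<open>T\<close>, the operator
  \<open>T\<close> itself is the least upper bound. Applied to the image of the constant one, this
  identifies its regular norm with its operator norm.\<close>

lemma operator_modulus_of_positive:
  assumes "positive_operator (blinfun_apply T)"
  shows "operator_modulus T = T"
proof (rule operator_modulus_eqI)
  show "T \<in> regular_operators"
    using assms by (rule positive_blinfun_regular)
  show "operator_le (- T) T"
    using assms order_trans[of "- blinfun_apply T x" 0 "blinfun_apply T x" for x]
    by (simp add: operator_le_iff blinfun.minus_left positive_operator_def)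
qed (simp_all add: operator_le_iff)

text \<open>The dominating \<open>U\<close> serves twice: it bounds the sets whose suprema are
  taken, and it makes the resulting linear map bounded.\<close>

lemma riesz_kantorovich_modulus:
  fixes T U :: "'e::banach_lattice \<Rightarrow>\<^sub>L 'e"
  assumes dc: "dedekind_complete TYPE('e)"
    and TU: "operator_le T U" "operator_le (- T) U"
  obtains S where "positive_operator (blinfun_apply S)"
    and "operator_le T S" and "operator_le (- T) S"
    and "\<And>R. operator_le T R \<Longrightarrow> operator_le (- T) R \<Longrightarrow> operator_le S R"
proof -
  define lub where "lub x s \<longleftrightarrow> (\<forall>y. \<bar>y\<bar> \<le> x \<longrightarrow> blinfun_apply T y \<le> s) \<and>
    (\<forall>u. (\<forall>y. \<bar>y\<bar> \<le> x \<longrightarrow> blinfun_apply T y \<le> u) \<longrightarrow> s \<le> u)" for x s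
  define M where "M x = (SOME s. lub x s)" for x
  have dom: "blinfun_apply T y \<le> blinfun_apply R x"
    if R: "operator_le T R" "operator_le (- T) R" and y: "\<bar>y\<bar> \<le> x" for R x y
  proof -
    \<comment> \<open>An operator above both \<open>T\<close> and \<open>- T\<close> is
      automatically positive, since it dominates an absolute value on the cone.\<close>
    have pos: "0 \<le> blinfun_apply R z" if "0 \<le> z" for z
    proof -
      have "\<bar>blinfun_apply T z\<bar> \<le> blinfun_apply R z"
        using R that by (intro abs_leI) (simp_all add: operator_le_iff blinfun.minus_left)
      with abs_ge_zero show ?thesis
        by (rule order_trans)
    qed
    have "blinfun_apply T y \<le> \<bar>blinfun_apply T y\<bar>"
      by (rule abs_ge_self)
    also have "\<dots> \<le> blinfun_apply R \<bar>y\<bar>"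
      using R by (intro linear_abs_le)
        (simp_all add: operator_le_iff linear_blinfun_apply blinfun.minus_left)
    also have "\<dots> \<le> blinfun_apply R x"
      using pos[of "x - \<bar>y\<bar>"] y by (simp add: blinfun.diff_right)
    finally show ?thesis .
  qed
  have M: "lub x (M x)" if "0 \<le> x" for x
  proof -
    let ?A = "blinfun_apply T ` {y. \<bar>y\<bar> \<le> x}"
    have "?A \<noteq> {}"
      using that by (auto intro: exI[of _ x])
    moreover have "bdd_above ?A"
      using dom[OF TU] by (intro bdd_aboveI[of _ "blinfun_apply U x"]) blast
    ultimately have "\<exists>s. (\<forall>a\<in>?A. a \<le> s) \<and> (\<forall>u. (\<forall>a\<in>?A. a \<le> u) \<longrightarrow> s \<le> u)"
      by (intro dc[unfolded dedekind_complete_def, THEN spec, THEN mp] conjI)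
    then have "\<exists>s. lub x s"
      by (simp add: lub_def)
    then show ?thesis
      unfolding M_def by (rule someI_ex)
  qed
  \<comment> \<open>The condition on \<open>y\<close> already forces \<open>x\<close> to be
    nonnegative, so the supremum exists.\<close>
  have M_ub: "blinfun_apply T y \<le> M x" if "\<bar>y\<bar> \<le> x" for x y
    using M[OF order_trans[OF abs_ge_zero that]] that by (simp add: lub_def)
  have M_least: "M x \<le> u" if "0 \<le> x" "\<And>y. \<bar>y\<bar> \<le> x \<Longrightarrow> blinfun_apply T y \<le> u" for x u
    using M[OF that(1)] that(2) by (simp add: lub_def)
  have M_add: "M (a + b) = M a + M b" if ab: "0 \<le> a" "0 \<le> b" for a b
  proof (rule antisym)
    show "M (a + b) \<le> M a + M b"
    proof (rule M_least)
      fix y :: 'e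
      assume "\<bar>y\<bar> \<le> a + b"
      then obtain u v where "y = u + v" "\<bar>u\<bar> \<le> a" "\<bar>v\<bar> \<le> b"
        using ab by (rule abs_le_decompose)
      then show "blinfun_apply T y \<le> M a + M b"
        by (simp add: blinfun.add_right add_mono M_ub)
    qed (use ab in simp)
    \<comment> \<open>Superadditivity takes one supremum at a time: first over \<open>u\<close> with
      \<open>v\<close> fixed, then over \<open>v\<close>.\<close>
    have "M a \<le> M (a + b) - blinfun_apply T v" if v: "\<bar>v\<bar> \<le> b" for v
    proof (rule M_least)
      fix u :: 'e
      assume "\<bar>u\<bar> \<le> a"
      then have "\<bar>u + v\<bar> \<le> a + b"
        using v abs_triangle_ineq add_mono order_trans by blast
      then show "blinfun_apply T u \<le> M (a + b) - blinfun_apply T v"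
        using M_ub[of "u + v"] by (simp add: blinfun.add_right le_diff_eq)
    qed (rule ab)
    then have "M b \<le> M (a + b) - M a"
      using ab by (intro M_least) (simp_all add: le_diff_eq add.commute)
    then show "M a + M b \<le> M (a + b)"
      by (simp add: le_diff_eq add.commute)
  qed
  have M_0: "M 0 = 0"
    using M_add[of 0 0] by simp
  have abs_scale: "\<bar>c *\<^sub>R y\<bar> \<le> c *\<^sub>R a" if "0 \<le> c" "\<bar>y\<bar> \<le> a" for c :: real and y a :: 'e
  proof (rule abs_leI)
    show "c *\<^sub>R y \<le> c *\<^sub>R a"
      using that by (intro scaleR_left_mono) (auto dest: abs_le_D1)
    have "c *\<^sub>R (- y) \<le> c *\<^sub>R a"
      using that by (intro scaleR_left_mono) (auto dest: abs_le_D2)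
    then show "- (c *\<^sub>R y) \<le> c *\<^sub>R a"
      by simp
  qed
  have M_scale_le: "c *\<^sub>R M a \<le> M (c *\<^sub>R a)" if "0 < c" "0 \<le> a" for c :: real and a
  proof -
    have "M a \<le> inverse c *\<^sub>R M (c *\<^sub>R a)"
    proof (rule M_least)
      fix y :: 'e
      assume "\<bar>y\<bar> \<le> a"
      then have "blinfun_apply T (c *\<^sub>R y) \<le> M (c *\<^sub>R a)"
        using that by (intro M_ub abs_scale) simp_all
      then have "inverse c *\<^sub>R (c *\<^sub>R blinfun_apply T y) \<le> inverse c *\<^sub>R M (c *\<^sub>R a)"
        using that by (intro scaleR_left_mono) (simp_all add: blinfun.scaleR_right)
      then show "blinfun_apply T y \<le> inverse c *\<^sub>R M (c *\<^sub>R a)"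
        using that by simp
    qed (rule that)
    then have "c *\<^sub>R M a \<le> c *\<^sub>R (inverse c *\<^sub>R M (c *\<^sub>R a))"
      using that by (intro scaleR_left_mono) simp_all
    then show ?thesis
      using that by simp
  qed
  have M_scale: "M (c *\<^sub>R a) = c *\<^sub>R M a" if "0 \<le> c" "0 \<le> a" for c :: real and a
  proof (cases "c = 0")
    case True
    then show ?thesis
      by (simp add: M_0)
  next
    case False
    with that have c: "0 < c"
      by simp
    \<comment> \<open>The reverse inequality is \<open>M_scale_le\<close> again, for the factor
      \<open>inverse c\<close> at the point \<open>c *\<^sub>R a\<close>.\<close>
    have "inverse c *\<^sub>R M (c *\<^sub>R a) \<le> M a"
      using M_scale_le[of "inverse c" "c *\<^sub>R a"] c scaleR_nonneg_nonneg[OF that] by simp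
    then have "c *\<^sub>R (inverse c *\<^sub>R M (c *\<^sub>R a)) \<le> c *\<^sub>R M a"
      using that by (intro scaleR_left_mono) simp_all
    then show ?thesis
      using M_scale_le[OF c that(2)] c by (simp add: antisym)
  qed
  obtain S where S: "linear S" "\<And>x. 0 \<le> x \<Longrightarrow> S x = M x"
    using linear_extension_from_cone[of M] M_add M_scale by blast
  \<comment> \<open>The choice \<open>y = 0\<close> is admissible in the supremum.\<close>
  have S_pos: "0 \<le> S x" if "0 \<le> x" for x
    using M_ub[of 0 x] that S(2) by simp
  have S_le: "S x \<le> blinfun_apply R x"
    if "operator_le T R" "operator_le (- T) R" "0 \<le> x" for R x
    using that dom S(2) by (simp add: M_least)
  \<comment> \<open>Boundedness comes from \<open>U\<close>: on the cone
    \<open>- S z \<le> 0 \<le> S z \<le> U z\<close>, so \<open>S\<close> and \<open>- S\<close> are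
    both dominated.\<close>
  have "bounded_linear S"
  proof (intro bounded_linear.intro bounded_linear_axioms.intro exI allI)
    fix x
    have "norm (S x) \<le> norm U * norm x"
    proof (rule dominated_linear_norm_le)
      show "- S z \<le> blinfun_apply U z" if "0 \<le> z" for z
        using S_pos[OF that] S_le[OF TU that] order_trans[of "- S z" 0 "blinfun_apply U z"]
          order_trans[of 0 "S z" "blinfun_apply U z"] by simp
    qed (use S S_le[OF TU] in simp_all)
    then show "norm (S x) \<le> norm x * norm U"
      by (simp add: mult.commute)
  qed (fact S(1))
  then have apply_S: "blinfun_apply (Blinfun S) = S"
    by (rule bounded_linear_Blinfun_apply)
  have "positive_operator (blinfun_apply (Blinfun S))"
    using S(1) S_pos by (simp add: apply_S positive_operator_def)
  moreover have "operator_le T (Blinfun S)"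
    using S(2) M_ub by (simp add: apply_S operator_le_iff)
  \<comment> \<open>The set of admissible \<open>y\<close> is symmetric, so \<open>y = - x\<close>
    gives the bound for \<open>- T\<close>.\<close>
  moreover have "operator_le (- T) (Blinfun S)"
    using S(2) M_ub[of "- x" x for x]
    by (simp add: apply_S operator_le_iff blinfun.minus_left blinfun.minus_right)
  moreover have "operator_le (Blinfun S) R" if "operator_le T R" "operator_le (- T) R" for R
    using S_le[OF that] by (simp add: apply_S operator_le_iff)
  ultimately show thesis
    by (rule that)
qed

text \<open>Minimality of the modulus \<open>S\<close> gives \<open>0 \<le> S \<le> U\<close>, and
  the norm estimate for dominated operators is then applied to \<open>S\<close> instead of
  \<open>T\<close>.\<close>

lemma regular_norm_le_of_operator_le:
  fixes T U :: "'e::banach_lattice \<Rightarrow>\<^sub>L 'e"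
  assumes "dedekind_complete TYPE('e)" and "operator_le T U" and "operator_le (- T) U"
  shows "regular_norm T \<le> norm U"
proof -
  obtain S where S: "positive_operator (blinfun_apply S)"
      "operator_le T S" "operator_le (- T) S"
      "\<And>R. operator_le T R \<Longrightarrow> operator_le (- T) R \<Longrightarrow> operator_le S R"
    using riesz_kantorovich_modulus[OF assms] by blast
  then have "operator_modulus T = S"
    by (intro operator_modulus_eqI positive_blinfun_regular)
  moreover have SU: "operator_le S U"
    using assms(2,3) by (rule S(4))
  moreover have "operator_le (- S) U"
  proof -
    have "- blinfun_apply S x \<le> blinfun_apply U x" if x: "0 \<le> x" for x
    proof -
      have "0 \<le> blinfun_apply S x"
        using S(1) x by (simp add: positive_operator_def)
      moreover have "blinfun_apply S x \<le> blinfun_apply U x"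
        using SU x by (simp add: operator_le_iff)
      ultimately show ?thesis
        by (meson neg_le_0_iff_le order_trans)
    qed
    then show ?thesis
      by (simp add: operator_le_iff blinfun.minus_left)
  qed
  ultimately show ?thesis
    by (simp add: regular_norm_def norm_le_of_operator_le)
qed

section \<open>Bounded measurable functions, the sup norm and the norm of a representation\<close>

lemma indicat_bounded_measurable: "indicat_real X \<in> bounded_measurable X \<Omega>"
proof -
  have "X \<in> sets (sigma X \<Omega>)"
    by (metis sets.top space_measure_of_conv)
  moreover have "bounded (indicat_real X ` X)"
    by (rule boundedI[of _ 1]) auto
  ultimately show ?thesis
    by (auto simp: bounded_measurable_def intro: borel_measurable_indicator)
qed

lemma abs_le_sup_norm:
  assumes "f \<in> bounded_measurable X \<Omega>" and "x \<in> X"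
  shows "\<bar>f x\<bar> \<le> sup_norm X f"
proof -
  obtain B where "\<forall>x\<in>X. \<bar>f x\<bar> \<le> B"
    using assms(1) by (auto simp: bounded_measurable_def bounded_iff)
  then have "bdd_above ((\<lambda>x. \<bar>f x\<bar>) ` X)"
    by (auto intro!: bdd_aboveI[of _ B])
  then have "\<bar>f x\<bar> \<le> (SUP x\<in>X. \<bar>f x\<bar>)"
    using assms(2) by (rule cSUP_upper2) simp
  then show ?thesis
    using assms(2) by (auto simp: sup_norm_def)
qed

lemma sup_norm_nonneg:
  assumes "f \<in> bounded_measurable X \<Omega>"
  shows "0 \<le> sup_norm X f"
proof (cases "X = {}")
  case False
  then obtain x where "x \<in> X"
    by blast
  then have "\<bar>f x\<bar> \<le> sup_norm X f"
    by (rule abs_le_sup_norm[OF assms])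
  then show ?thesis
    by linarith
qed (simp add: sup_norm_def)

lemma sup_norm_indicat_le: "sup_norm X (indicat_real X) \<le> 1"
  by (auto simp: sup_norm_def intro!: cSUP_least)

text \<open>The parameter \<nu> lets one argument serve both the operator norm and the regular norm.
  The supremum over the unit ball is a maximum, attained at the constant one; this includes empty
  \<open>X\<close>, where that function has sup norm 0 and still lies in the ball.\<close>

lemma bounded_representation_of_dominated:
  assumes le: "\<And>f. f \<in> bounded_measurable X \<Omega> \<Longrightarrow> \<nu> (\<pi> f) \<le> sup_norm X f * \<nu> (\<pi> (indicat_real X))"
    and nonneg: "0 \<le> \<nu> (\<pi> (indicat_real X))"
  shows "bounded_representation X \<Omega> \<nu> \<pi> \<and>
    representation_norm X \<Omega> \<nu> \<pi> = \<nu> (\<pi> (indicat_real X))"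
proof
  show "bounded_representation X \<Omega> \<nu> \<pi>"
    unfolding bounded_representation_def using le
    by (intro exI[of _ "\<nu> (\<pi> (indicat_real X))"]) (simp add: mult.commute)
  show "representation_norm X \<Omega> \<nu> \<pi> = \<nu> (\<pi> (indicat_real X))"
    unfolding representation_norm_def
  proof (rule cSup_eq_maximum)
    show "\<nu> (\<pi> (indicat_real X)) \<in>
        (\<lambda>f. \<nu> (\<pi> f)) ` {f \<in> bounded_measurable X \<Omega>. sup_norm X f \<le> 1}"
      using indicat_bounded_measurable[of X \<Omega>] sup_norm_indicat_le by blast
  next
    fix r
    assume "r \<in> (\<lambda>f. \<nu> (\<pi> f)) ` {f \<in> bounded_measurable X \<Omega>. sup_norm X f \<le> 1}"
    then obtain f where f: "f \<in> bounded_measurable X \<Omega>" "sup_norm X f \<le> 1" "r = \<nu> (\<pi> f)"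
      by blast
    have "r \<le> sup_norm X f * \<nu> (\<pi> (indicat_real X))"
      using f le by simp
    also have "\<dots> \<le> 1 * \<nu> (\<pi> (indicat_real X))"
      using f(2) nonneg by (rule mult_right_mono)
    finally show "r \<le> \<nu> (\<pi> (indicat_real X))"
      by simp
  qed
qed

section \<open>Order bounds for a positive representation\<close>

lemma bounded_measurable_scale:
  assumes "f \<in> bounded_measurable X \<Omega>"
  shows "(\<lambda>x. c * f x) \<in> bounded_measurable X \<Omega>"
proof -
  have "bounded ((\<lambda>y. c *\<^sub>R y) ` f ` X)"
    using assms by (intro bounded_scaling) (simp add: bounded_measurable_def)
  then show ?thesis
    using assms by (auto simp: bounded_measurable_def image_image intro: borel_measurable_times)
qed

lemma bounded_measurable_add:
  assumes "f \<in> bounded_measurable X \<Omega>" and "g \<in> bounded_measurable X \<Omega>"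
  shows "(\<lambda>x. f x + g x) \<in> bounded_measurable X \<Omega>"
  using assms by (auto simp: bounded_measurable_def intro: bounded_plus_comp borel_measurable_add)

lemma positive_representation_dominated:
  assumes \<pi>: "positive_representation X \<Omega> \<pi>"
    and f: "f \<in> bounded_measurable X \<Omega>"
  shows "operator_le (\<pi> f) (sup_norm X f *\<^sub>R \<pi> (indicat_real X))"
    and "operator_le (- \<pi> f) (sup_norm X f *\<^sub>R \<pi> (indicat_real X))"
proof -
  let ?c = "sup_norm X f"
  note one = indicat_bounded_measurable[of X \<Omega>]
  \<comment> \<open>The sign \<open>s\<close> treats both bounds together: the function
    \<open>?c + s * f\<close> is nonnegative on \<open>X\<close>, so its image is a positive
    operator. Taking \<open>s = - 1\<close> bounds \<open>\<pi> f\<close>, and \<open>s = 1\<close>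
    bounds \<open>- \<pi> f\<close>.\<close>
  have key: "positive_operator (blinfun_apply (?c *\<^sub>R \<pi> (indicat_real X) + s *\<^sub>R \<pi> f))"
    if s: "\<bar>s\<bar> = 1" for s :: real
  proof -
    let ?g = "\<lambda>x. ?c * indicat_real X x + s * f x"
    have "?g \<in> bounded_measurable X \<Omega>"
      by (intro bounded_measurable_add bounded_measurable_scale one f)
    moreover have "0 \<le> ?g x" if "x \<in> X" for x
    proof -
      have "\<bar>s * f x\<bar> \<le> ?c"
        using abs_le_sup_norm[OF f that] s by (simp add: abs_mult)
      then show ?thesis
        using that by simp
    qed
    ultimately have "positive_operator (blinfun_apply (\<pi> ?g))"
      using \<pi> by (simp add: positive_representation_def)
    moreover have "\<pi> ?g = \<pi> (\<lambda>x. ?c * indicat_real X x) + \<pi> (\<lambda>x. s * f x)"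
      using \<pi> bounded_measurable_scale[OF one, of ?c] bounded_measurable_scale[OF f, of s]
      unfolding positive_representation_def by simp
    moreover have "\<dots> = ?c *\<^sub>R \<pi> (indicat_real X) + s *\<^sub>R \<pi> f"
      using \<pi> one f unfolding positive_representation_def by simp
    ultimately show ?thesis
      by simp
  qed
  show "operator_le (\<pi> f) (?c *\<^sub>R \<pi> (indicat_real X))"
    using key[of "- 1"] by (simp add: operator_le_def)
  show "operator_le (- \<pi> f) (?c *\<^sub>R \<pi> (indicat_real X))"
    using key[of 1] by (simp add: operator_le_def)
qed

theorem proposition4p5:
  fixes X :: "'a set" and \<Omega> :: "'a set set"
    and \<pi> :: "('a \<Rightarrow> real) \<Rightarrow> ('e::banach_lattice \<Rightarrow>\<^sub>L 'e)"
  assumes "sigma_algebra X \<Omega>"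
    and "positive_representation X \<Omega> \<pi>"
    and "\<forall>f\<in>bounded_measurable X \<Omega>. \<pi> f \<in> regular_operators"
  shows "(bounded_representation X \<Omega> norm \<pi> \<and>
          representation_norm X \<Omega> norm \<pi> = norm (\<pi> (indicat_real X))) \<and>
         (dedekind_complete TYPE('e) \<longrightarrow>
          bounded_representation X \<Omega> regular_norm \<pi> \<and>
          representation_norm X \<Omega> norm \<pi> = representation_norm X \<Omega> regular_norm \<pi> \<and>
          representation_norm X \<Omega> regular_norm \<pi> = norm (\<pi> (indicat_real X)))"
proof -
  let ?P = "\<pi> (indicat_real X)"
  note one = indicat_bounded_measurable[of X \<Omega>]
  note dom = positive_representation_dominated[OF assms(2)]
  have norm_c: "norm (sup_norm X f *\<^sub>R ?P) = sup_norm X f * norm ?P"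
    if "f \<in> bounded_measurable X \<Omega>" for f
    using sup_norm_nonneg[OF that] by (simp add: abs_of_nonneg)
  have 1: "bounded_representation X \<Omega> norm \<pi> \<and> representation_norm X \<Omega> norm \<pi> = norm ?P"
    using norm_le_of_operator_le[OF dom]
    by (intro bounded_representation_of_dominated) (simp_all only: norm_c norm_ge_zero)
  \<comment> \<open>Positivity makes \<open>?P\<close> its own modulus, so the maxima computed for
    the two norms coincide.\<close>
  have "positive_operator (blinfun_apply ?P)"
    using assms(2) one by (simp add: positive_representation_def)
  then have P: "regular_norm ?P = norm ?P"
    by (simp add: regular_norm_def operator_modulus_of_positive)
  have 2: "bounded_representation X \<Omega> regular_norm \<pi> \<and>
      representation_norm X \<Omega> regular_norm \<pi> = regular_norm ?P"
    if "dedekind_complete TYPE('e)"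
    using regular_norm_le_of_operator_le[OF that dom]
    by (intro bounded_representation_of_dominated) (simp_all only: norm_c P norm_ge_zero)
  show ?thesis
    using 1 2 P by simp
qed

end
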